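(* Consider a general inventory system with $n$ items, whose bill-of-materials network has adjacency matrix $A\in\mathbb{R}^{n\times n}$, $m$ arcs and density $\rho = \frac{m}{n(n-1)}$. Let the BP algorithm be the back-propagation procedure described in the context (a recording part followed by a backward part), which computes the sample-path gradient $\frac{\partial C_T^{sum}}{\partial S}$ of the total cost with respect to the base-stock levels $S\in\mathbb{R}^n$. Then: (i) the computational complexity of the BP algorithm for a simulation with $T$ periods is $O(Tn^2)$; (ii) if sparse matrix techniques are used to handle the adjacency matrix $A$, the computational complexity is $O(T\rho n^2)$; (iii) if, furthermore, $n\rho\sim\text{constant}$ (i.e. the average in-degree $m/n=(n-1)\rho\approx n\rho$ is a constant that does not grow with $n$), the computational complexity may be reduced to $O(Tn)$.
   Context: **Network.** There are $n$ items, divided into raw material items (procured from outside) and production items (sub-assemblies and final products). The bill of materials (BOM) is represented by a directed network on the items. Its adjacency matrix $A=(a_{ij})$ has $a_{ij}>0$ if $a_{ij}$ units of item $i$ are required to produce one unit of the (downstream) item $j$ (an arc $i\to j$ of weight $a_{ij}$), and $a_{ij}=0$ if there is no arc. $m$ is the number of arcs, and $\rho=m/(n(n-1))$. The number of layers of the BOM network is $n_l=\sup\{r\in\mathbb{N}: (A^r)_{ij}>0 \text{ for some } i,j\}+1$. **Data.** Given are: row vectors $S$ (base-stock levels), $h$ (unit holding costs), $p$ (unit stockout penalties), $I^{initial}$ (initial on-hand inventory), all in $\mathbb{R}^n$; outside demand vectors $D_t^{out}\in\mathbb{R}^n$; and integer lead times $l_{t,i}$. All other simulation quantities with a single time index $t$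 are row vectors in $\mathbb{R}^n$, except the scalars $C_t$, $C_t^{sum}$; a second index $i$ denotes the $i$-th component. $\min$, $\max$ and division of vectors are element-wise. **Simulation** (its values are available to the gradient procedure). Initialize $IP_0=I_0=I^{initial}$, $O_0=0$, $D_0^{out}=0$, $B_0^{out}=0$, $O_0^b=0$, $C_0^{sum}=0$. For $t=1,\dots,T$: $IP_t\leftarrow IP_{t-1}+O_{t-1}-O_{t-1}A^T-D_{t-1}^{out}$; $O_t\leftarrow-\min\{0,IP_t-D_t^{out}-S\}$; for $l=1,\dots,n_l-1$: $IP_t^{temp}\leftarrow IP_t-D_t^{out}-O_tA^T$ and $O_t\leftarrow-\min\{0,IP_t^{temp}-S\}$; $I_t^{temp}= I_{t-1}+P_t-B_{t-1}^{out}-D_t^{out}$; $I_t^0\leftarrow\max\{0,I_t^{temp}\}$; $B_t^{out}\leftarrow-\min\{0,I_t^{temp}\}$; for each raw material item $i$: $P_{t+l_{t,i},i}\leftarrow O_{t,i}$; $I_t^{need}=(O_t+O_{t-1}^b)A^T$; $r_t\leftarrow\min\{I_t^0/I_t^{need},1\}$; for each production item $i$: $k_{t,i}=\min_{j:\,a_{ji}\ne0}\{r_{t,j}\}$, $M_{t,i}\leftarrow k_{t,i}(O_{t,i}+O_{t-1,i}^b)$, $P_{t+l_{t,i},i}\leftarrow M_{t,i}$; $O_t^b\leftarrow O_t+O_{t-1}^b-M_t$; $I_t\leftarrow I_t^0-M_tA^T$; $C_t\leftarrow I_th^T+B_t^{out}p^T$; $C_t^{sum}\leftarrow C_{t-1}^{sum}+C_t$.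 **BP algorithm.** $E$ is the $n\times n$ identity matrix, $1_{\{\cdot\}}$ is the (element-wise) indicator, $diag(v)$ is the diagonal matrix with diagonal $v$. Every $\frac{\partial C_T^{sum}}{\partial X}$ with $X$ a vector is a $1\times n$ row vector. *Part 1 (recording, during the simulation).* For $t=1,\dots,T$ do: 1. push $\frac{\partial O_t}{\partial IP_t}=diag(-1_{\{IP_t-D_t^{out}-S<0\}})$ into Stack 1; for $k=1,\dots,n_l-1$ push $\frac{\partial O_t}{\partial IP_t^{temp}}=diag(-1_{\{IP_t^{temp}-S<0\}})$ (for the current $IP_t^{temp}$) into Stack 1; 2. record $\frac{\partial I_t^0}{\partial I_t^{temp}}=diag(1_{\{I_t^{temp}>0\}})$ and $\frac{\partial B_t^{out}}{\partial I_t^{temp}}=diag(-1_{\{I_t^{temp}\le0\}})$; 3. for each item $i$ with a procurement order in period $t$: record $i$ in List 1 and $l_{t,i}$ in List 2 of period $t+l_{t,i}$; 4. record $\frac{\partial r_t}{\partial I_t^0}=diag(1_{\{I_t^0/I_t^{need}<1\}})diag(1/I_t^{need})$ and $\frac{\partial r_t}{\partial I_t^{need}}=-diag(1_{\{I_t^0/I_t^{need}<1\}})diag(1/I_t^{need})diag(I_t^0/I_t^{need})$; 5. for each item $i$ whose started production in period $t$ is nonzero: record $i$ in List 3 and $l_{t,i}$ in List 4 of period $t+l_{t,i}$; record $k_{t,i}$ and $\frac{\partial M_{t,i}}{\partial r_t}=(O_{t,i}+O_{t-1,i}^b)\left(1_{\{r_{t,j}=k_{t,i},\,a_{ji}\ne0\}}\right)_{j=1,\dots,n}$.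 *Part 2 (backward).* Write $G(X)$ for $\frac{\partial C_T^{sum}}{\partial X}$. Initialize $G(I_{T+1}^{temp})=0$, $G(IP_T)=0$, $G(S)=0$, $G(O_T^b)=0$, and $G(r_t)=G(O_t)=G(M_t)=0$ for $t=1,\dots,T$. For $t=T,T-1,\dots,1$ do: 1. $G(I_t)\leftarrow h+G(I_{t+1}^{temp})$; $G(B_t^{out})\leftarrow p-G(I_{t+1}^{temp})$; 2. $G(M_t)\leftarrow G(M_t)-G(I_t)A-G(O_t^b)$; 3. $G(O'_t)\leftarrow G(O_t^b)+G(M_t)\,diag((k_{t,i})_{i})$ (where $O'_t$ is an auxiliary variable denoting $O_t+O_{t-1}^b$); 4. for each item $i$ whose started production in period $t$ is nonzero: $G(r_t)\leftarrow G(r_t)+G(M_{t,i})\frac{\partial M_{t,i}}{\partial r_t}$; 5. $G(I_t^0)\leftarrow G(I_t)+G(r_t)\frac{\partial r_t}{\partial I_t^0}$; $G(I_t^{need})\leftarrow G(r_t)\frac{\partial r_t}{\partial I_t^{need}}$; $G(O'_t)\leftarrow G(O'_t)+G(I_t^{need})A$; 6. $G(I_t^{temp})\leftarrow G(I_t^0)\frac{\partial I_t^0}{\partial I_t^{temp}}+G(B_t^{out})\frac{\partial B_t^{out}}{\partial I_t^{temp}}$; 7. $G(O_t)\leftarrow G(O_t)+G(O'_t)+G(IP_t)(E-A)$; 8. for $k=1,\dots,n_l-1$: pop $\frac{\partial O_t}{\partial IP_t^{temp}}$ from Stack 1; $G(IP_t^{temp})\leftarrow G(O_t)\frac{\partial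 O_t}{\partial IP_t^{temp}}$; $G(S)\leftarrow G(S)-G(IP_t^{temp})$; $G(IP_t)\leftarrow G(IP_t)+G(IP_t^{temp})$; $G(O_t)\leftarrow-G(IP_t^{temp})A$; 9. pop $\frac{\partial O_t}{\partial IP_t}$ from Stack 1; $G(S)\leftarrow G(S)-G(O_t)\frac{\partial O_t}{\partial IP_t}$; $G(IP_{t-1})\leftarrow G(IP_t)+G(O_t)\frac{\partial O_t}{\partial IP_t}$; 10. $G(O_{t-1}^b)\leftarrow G(O'_t)$; $G(P_t)\leftarrow G(I_t^{temp})$; 11. for each item $i$ in List 1 of period $t$: get the recorded lead time $l_{u,i}$ from List 2 (where $u=t-l_{u,i}$) and set $G(O_{t-l_{u,i},i})\leftarrow G(P_{t,i})$; for each item $i$ in List 3 of period $t$: get the recorded lead time $l_{u,i}$ from List 4 (where $u=t-l_{u,i}$) and set $G(M_{t-l_{u,i},i})\leftarrow G(P_{t,i})$. **Cost model.** Computational complexity counts elementary scalar operations (additions, multiplications, divisions, comparisons, assignments, stack/list operations on a scalar), each of cost $O(1)$. Addition of two $n$-vectors costs $O(n)$; multiplying a $1\times n$ vector by a dense $n\times n$ matrix costs $O(n^2)$. Diagonal matrices are stored by their diagonals, so forming one or multiplying a $1\times n$ vector by one costs $O(n)$. Using sparse matrix techniques for $A$ means that only the nonzero entries of $A$ are stored and processed, so the product of a $1\times n$ vector with $A$ or $A^T$ costs $O(\rho n^2)$, and operations indexed by $\{j:a_{ji}\ne0\}$ involve only the nonzero entries of column $i$.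
   Formalization: The number of layers n_l is assumed bounded (step 8 does n_l-1 vector-matrix products per period, so all three bounds fail for a chain), and part (ii) also assumes n = O(m) (vector additions cost order Tn, so (ii) fails e.g. for m = 0). *)

theory Defs
  imports
    "HOL-Library.Monad_Syntax"
    "HOL-Library.Landau_Symbols"
    "Jordan_Normal_Form.Matrix"
begin

section \<open>Elementary scalar operations and their cost\<close>

text \<open>
  A timed computation carries its result and the number of elementary scalar operations
  performed. Every addition, subtraction, multiplication, division, comparison, assignment and
  stack or list operation on a scalar counts one; loops also pay one comparison per iteration.
  Reading a stored scalar is free.
\<close>

datatype 'a timed = Timed (val: 'a) (cost: nat)

definition return :: "'a \<Rightarrow> 'a timed" where
  "return x = Timed x 0"

definition timed_bind :: "'a timed \<Rightarrow> ('a \<Rightarrow> 'b timed) \<Rightarrow> 'b timed" where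
  "timed_bind m f = Timed (val (f (val m))) (cost m + cost (f (val m)))"

adhoc_overloading Monad_Syntax.bind \<rightleftharpoons> timed_bind

definition add :: "real \<Rightarrow> real \<Rightarrow> real timed" where
  "add x y = Timed (x + y) 1"

definition sub :: "real \<Rightarrow> real \<Rightarrow> real timed" where
  "sub x y = Timed (x - y) 1"

definition mul :: "real \<Rightarrow> real \<Rightarrow> real timed" where
  "mul x y = Timed (x * y) 1"

definition divide_by :: "real \<Rightarrow> real \<Rightarrow> real timed" where
  "divide_by x y = Timed (x / y) 1"

definition less_than :: "real \<Rightarrow> real \<Rightarrow> bool timed" where
  "less_than x y = Timed (x < y) 1"

definition equal_to :: "real \<Rightarrow> real \<Rightarrow> bool timed" where
  "equal_to x y = Timed (x = y) 1"

definition add_nat :: "nat \<Rightarrow> nat \<Rightarrow> nat timed" where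
  "add_nat x y = Timed (x + y) 1"

definition sub_nat :: "nat \<Rightarrow> nat \<Rightarrow> nat timed" where
  "sub_nat x y = Timed (x - y) 1"

definition assign :: "real vec \<Rightarrow> nat \<Rightarrow> real \<Rightarrow> real vec timed" where
  "assign v i x = Timed (vec (dim_vec v) (\<lambda>j. if j = i then x else v $ j)) 1"

definition append_item :: "'a list \<Rightarrow> 'a \<Rightarrow> 'a list timed" where
  "append_item xs x = Timed (xs @ [x]) 1"

text \<open>A stack of vectors with \<open>n\<close> components; each component is moved separately.\<close>

definition push :: "nat \<Rightarrow> real vec \<Rightarrow> real vec list \<Rightarrow> real vec list timed" where
  "push n v st = Timed (v # st) n"

definition pop :: "nat \<Rightarrow> real vec list \<Rightarrow> (real vec \<times> real vec list) timed" where
  "pop n st = Timed (hd st, tl st) n"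

fun for_each :: "'b list \<Rightarrow> ('b \<Rightarrow> 's \<Rightarrow> 's timed) \<Rightarrow> 's \<Rightarrow> 's timed" where
  "for_each [] body s = return s"
| "for_each (x # xs) body s =
     do { s' \<leftarrow> Timed s 1; s'' \<leftarrow> body x s'; for_each xs body s'' }"

text \<open>
  The loop ``for \<open>i = 0, \<dots>, n - 1\<close>: assign \<open>f i\<close> to component \<open>i\<close>''. Besides evaluating
  \<open>f i\<close>, each iteration pays the loop comparison and the assignment.
\<close>

definition build_vec :: "nat \<Rightarrow> (nat \<Rightarrow> real timed) \<Rightarrow> real vec timed" where
  "build_vec n f = Timed (vec n (\<lambda>i. val (f i))) (\<Sum>i<n. cost (f i) + 2)"

definition vec_zero :: "nat \<Rightarrow> real vec timed" where
  "vec_zero n = build_vec n (\<lambda>i. return 0)"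

definition vec_copy :: "nat \<Rightarrow> real vec \<Rightarrow> real vec timed" where
  "vec_copy n u = build_vec n (\<lambda>i. return (u $ i))"

definition vec_add :: "nat \<Rightarrow> real vec \<Rightarrow> real vec \<Rightarrow> real vec timed" where
  "vec_add n u v = build_vec n (\<lambda>i. add (u $ i) (v $ i))"

definition vec_sub :: "nat \<Rightarrow> real vec \<Rightarrow> real vec \<Rightarrow> real vec timed" where
  "vec_sub n u v = build_vec n (\<lambda>i. sub (u $ i) (v $ i))"

text \<open>Row vector times diagonal matrix, the latter stored by its diagonal \<open>d\<close>.\<close>

definition vec_diag :: "nat \<Rightarrow> real vec \<Rightarrow> real vec \<Rightarrow> real vec timed" where
  "vec_diag n u d = build_vec n (\<lambda>i. mul (u $ i) (d $ i))"

text \<open>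
  Row vector times matrix. A storage scheme \<open>stored\<close> lists, for every column \<open>j\<close>, the row indices of
  the entries that are stored and therefore processed.
\<close>

definition vec_mat :: "nat \<Rightarrow> (nat \<Rightarrow> nat list) \<Rightarrow> real vec \<Rightarrow> real mat \<Rightarrow> real vec timed" where
  "vec_mat n stored u A = build_vec n (\<lambda>j.
     for_each (stored j) (\<lambda>i s. do { x \<leftarrow> mul (u $ i) (A $$ (i, j)); add s x }) 0)"


section \<open>Inventory systems\<close>

text \<open>Items are \<open>0, \<dots>, n - 1\<close>; periods are \<open>1, \<dots>, horizon\<close>.\<close>

record inventory =
  items :: nat
  bom :: "real mat"
  base_stock :: "real vec"
  holding :: "real vec"
  penalty :: "real vec"
  initial_inv :: "real vec"
  outside_demand :: "nat \<Rightarrow> real vec"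
  lead_time :: "nat \<Rightarrow> nat \<Rightarrow> nat"
  horizon :: nat

text \<open>\<open>{r. (A\<^sup>r)\<^sub>i\<^sub>j > 0 for some i, j}\<close>\<close>

definition path_lengths :: "inventory \<Rightarrow> nat set" where
  "path_lengths sys =
     {r. \<exists>i<items sys. \<exists>j<items sys. (bom sys ^\<^sub>m r) $$ (i, j) > 0}"

text \<open>The supremum in \<^typ>\<open>nat\<close> is meaningful because \<open>inventory_system\<close> below requires
  boundedness, i.e. an acyclic network.\<close>

definition layers :: "inventory \<Rightarrow> nat" where
  "layers sys = Sup (path_lengths sys) + 1"

definition inventory_system :: "inventory \<Rightarrow> bool" where
  "inventory_system sys \<longleftrightarrow>
     items sys \<ge> 1 \<and> horizon sys \<ge> 1 \<and>
     bom sys \<in> carrier_mat (items sys) (items sys) \<and>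
     (\<forall>i<items sys. \<forall>j<items sys. bom sys $$ (i, j) \<ge> 0) \<and>
     bdd_above (path_lengths sys) \<and>
     base_stock sys \<in> carrier_vec (items sys) \<and>
     holding sys \<in> carrier_vec (items sys) \<and>
     penalty sys \<in> carrier_vec (items sys) \<and>
     initial_inv sys \<in> carrier_vec (items sys) \<and>
     (\<forall>t\<in>{1..horizon sys}. outside_demand sys t \<in> carrier_vec (items sys))"

definition arcs :: "inventory \<Rightarrow> nat" where
  "arcs sys = card {(i, j). i < items sys \<and> j < items sys \<and> bom sys $$ (i, j) \<noteq> 0}"

definition density :: "inventory \<Rightarrow> real" where
  "density sys = real (arcs sys) / (real (items sys) * (real (items sys) - 1))"

text \<open>Raw material items are the ones that need no components.\<close>

definition raw_material :: "inventory \<Rightarrow> nat \<Rightarrow> bool" where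
  "raw_material sys i \<longleftrightarrow> (\<forall>j<items sys. bom sys $$ (j, i) = 0)"

definition demand :: "inventory \<Rightarrow> nat \<Rightarrow> real vec" where
  "demand sys t = (if t = 0 then 0\<^sub>v (items sys) else outside_demand sys t)"


section \<open>Simulation\<close>

text \<open>
  All values of period \<open>t\<close>. Here \<open>IPtemp l\<close> and \<open>IP\<close> are the inventory positions, \<open>Ord\<close> is \<open>O\<close>,
  \<open>Ordb\<close> is \<open>O\<^sup>b\<close>, \<open>Istart\<close> is \<open>I\<^sup>0\<close>, and \<open>Proc u\<close> is \<open>P\<^sub>u\<close> as far as it has been assigned
  by the end of period \<open>t\<close>.
\<close>

record period =
  IP :: "real vec"
  IPtemp :: "nat \<Rightarrow> real vec"
  Ord :: "real vec"
  Itemp :: "real vec"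
  Istart :: "real vec"
  Bout :: "real vec"
  Ineed :: "real vec"
  fill :: "real vec"
  kmin :: "real vec"
  Mst :: "real vec"
  Ordb :: "real vec"
  Inv :: "real vec"
  Proc :: "nat \<Rightarrow> real vec"

definition order_up_to :: "inventory \<Rightarrow> real vec \<Rightarrow> real vec" where
  "order_up_to sys x = vec (items sys) (\<lambda>i. - min 0 (x $ i - base_stock sys $ i))"

text \<open>
  \<open>order_pass sys x l\<close> is the order vector after \<open>l\<close> passes of the inner loop, started from
  \<open>x = IP\<^sub>t - D\<^sub>t\<close>. As \<^const>\<open>mult_mat_vec\<close> works on column vectors, \<open>O A\<^sup>T\<close> is \<open>A *\<^sub>v O\<close>.
\<close>

fun order_pass :: "inventory \<Rightarrow> real vec \<Rightarrow> nat \<Rightarrow> real vec" where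
  "order_pass sys x 0 = order_up_to sys x"
| "order_pass sys x (Suc l) = order_up_to sys (x - bom sys *\<^sub>v order_pass sys x l)"

text \<open>
  Two conventions: a component that nobody needs (\<open>Ineed = 0\<close>, quotient infinite) has
  \<open>fill = 1\<close>, whereas division by zero in HOL would give \<open>0\<close>; and \<open>kmin = 0\<close>, hence no production,
  for raw material.
\<close>

definition next_period :: "inventory \<Rightarrow> nat \<Rightarrow> period \<Rightarrow> period" where
  "next_period sys t s = (let
     n = items sys; A = bom sys; D = demand sys t;
     ip = IP s + Ord s - A *\<^sub>v Ord s - demand sys (t - 1);
     ord = order_pass sys (ip - D) (layers sys - 1);
     itemp = Inv s + Proc s t - Bout s - D;
     istart = vec n (\<lambda>i. max 0 (itemp $ i));
     bout = vec n (\<lambda>i. - min 0 (itemp $ i));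
     ineed = A *\<^sub>v (ord + Ordb s);
     r = vec n (\<lambda>i. if ineed $ i = 0 then 1 else min (istart $ i / ineed $ i) 1);
     k = vec n (\<lambda>i. if raw_material sys i then 0
                    else Min {r $ j | j. j < n \<and> A $$ (j, i) \<noteq> 0});
     m = vec n (\<lambda>i. k $ i * (ord $ i + Ordb s $ i))
   in \<lparr> IP = ip,
        IPtemp = (\<lambda>l. ip - D - A *\<^sub>v order_pass sys (ip - D) (l - 1)),
        Ord = ord, Itemp = itemp, Istart = istart, Bout = bout, Ineed = ineed,
        fill = r, kmin = k, Mst = m,
        Ordb = ord + Ordb s - m,
        Inv = istart - A *\<^sub>v m,
        Proc = (\<lambda>u. vec n (\<lambda>i.
          if u = t + lead_time sys t i
          then (if raw_material sys i then ord $ i else m $ i)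
          else Proc s u $ i)) \<rparr>)"

fun sim :: "inventory \<Rightarrow> nat \<Rightarrow> period" where
  "sim sys 0 = (let z = 0\<^sub>v (items sys) in
     \<lparr> IP = initial_inv sys, IPtemp = (\<lambda>l. z), Ord = z, Itemp = z, Istart = z, Bout = z,
       Ineed = z, fill = z, kmin = z, Mst = z, Ordb = z, Inv = initial_inv sys,
       Proc = (\<lambda>u. z) \<rparr>)"
| "sim sys (Suc t) = next_period sys (Suc t) (sim sys t)"


section \<open>Back-propagation, part 1: recording\<close>

text \<open>
  \<open>dM t i\<close> holds the stored entries of \<open>\<partial>M\<^sub>t\<^sub>,\<^sub>i/\<partial>r\<^sub>t\<close> as index-value pairs.
\<close>

record tape =
  stack1 :: "real vec list"
  dIstart_dItemp :: "nat \<Rightarrow> real vec"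
  dBout_dItemp :: "nat \<Rightarrow> real vec"
  dr_dIstart :: "nat \<Rightarrow> real vec"
  dr_dIneed :: "nat \<Rightarrow> real vec"
  list1 :: "nat \<Rightarrow> nat list"
  list2 :: "nat \<Rightarrow> nat list"
  list3 :: "nat \<Rightarrow> nat list"
  list4 :: "nat \<Rightarrow> nat list"
  krec :: "nat \<Rightarrow> nat \<Rightarrow> real"
  dM :: "nat \<Rightarrow> nat \<Rightarrow> (nat \<times> real) list"

definition empty_tape :: tape where
  "empty_tape = \<lparr> stack1 = [],
     dIstart_dItemp = (\<lambda>t. 0\<^sub>v 0), dBout_dItemp = (\<lambda>t. 0\<^sub>v 0),
     dr_dIstart = (\<lambda>t. 0\<^sub>v 0), dr_dIneed = (\<lambda>t. 0\<^sub>v 0),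
     list1 = (\<lambda>t. []), list2 = (\<lambda>t. []), list3 = (\<lambda>t. []), list4 = (\<lambda>t. []),
     krec = (\<lambda>t i. 0), dM = (\<lambda>t i. []) \<rparr>"

text \<open>Diagonal with entry \<open>-1\<close> where \<open>y\<close> is negative, and \<open>0\<close> elsewhere.\<close>

definition neg_indicator :: "nat \<Rightarrow> (nat \<Rightarrow> real timed) \<Rightarrow> real vec timed" where
  "neg_indicator n y = build_vec n (\<lambda>i. do {
     x \<leftarrow> y i; b \<leftarrow> less_than x 0; return (if b then -1 else 0) })"

definition record_orders :: "inventory \<Rightarrow> nat \<Rightarrow> tape \<Rightarrow> tape timed" where
  "record_orders sys t tp = (let n = items sys; s = sim sys t; S = base_stock sys in do {
     d \<leftarrow> neg_indicator n (\<lambda>i. do { x \<leftarrow> sub (IP s $ i) (demand sys t $ i); sub x (S $ i) });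
     st \<leftarrow> push n d (stack1 tp);
     st \<leftarrow> for_each [1..<layers sys] (\<lambda>l st. do {
             d \<leftarrow> neg_indicator n (\<lambda>i. sub (IPtemp s l $ i) (S $ i));
             push n d st }) st;
     return (tp\<lparr> stack1 := st \<rparr>) })"

definition record_inventory :: "inventory \<Rightarrow> nat \<Rightarrow> tape \<Rightarrow> tape timed" where
  "record_inventory sys t tp = (let n = items sys; s = sim sys t in do {
     d0 \<leftarrow> build_vec n (\<lambda>i. do {
             b \<leftarrow> less_than 0 (Itemp s $ i); return (if b then 1 else 0) });
     dB \<leftarrow> build_vec n (\<lambda>i. do {
             b \<leftarrow> less_than 0 (Itemp s $ i); return (if b then 0 else -1) });
     return (tp\<lparr> dIstart_dItemp := (dIstart_dItemp tp)(t := d0),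
                 dBout_dItemp := (dBout_dItemp tp)(t := dB) \<rparr>) })"

definition record_procurement :: "inventory \<Rightarrow> nat \<Rightarrow> tape \<Rightarrow> tape timed" where
  "record_procurement sys t tp = (let s = sim sys t in
     for_each [0..<items sys] (\<lambda>i tp. do {
       raw \<leftarrow> Timed (raw_material sys i) 1;
       z \<leftarrow> equal_to (Ord s $ i) 0;
       if raw \<and> \<not> z then do {
         u \<leftarrow> add_nat t (lead_time sys t i);
         l1 \<leftarrow> append_item (list1 tp u) i;
         l2 \<leftarrow> append_item (list2 tp u) (lead_time sys t i);
         return (tp\<lparr> list1 := (list1 tp)(u := l1), list2 := (list2 tp)(u := l2) \<rparr>) }
       else return tp }) tp)"

text \<open>In accordance with \<^const>\<open>next_period\<close>, the indicator \<open>Istart / Ineed < 1\<close> is false if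
  \<open>Ineed = 0\<close>.\<close>

definition record_fill :: "inventory \<Rightarrow> nat \<Rightarrow> tape \<Rightarrow> tape timed" where
  "record_fill sys t tp = (let n = items sys; s = sim sys t in do {
     d0 \<leftarrow> build_vec n (\<lambda>i. do {
             z \<leftarrow> equal_to (Ineed s $ i) 0;
             q \<leftarrow> divide_by (Istart s $ i) (Ineed s $ i);
             b \<leftarrow> less_than q 1;
             v \<leftarrow> divide_by 1 (Ineed s $ i);
             mul (if \<not> z \<and> b then 1 else 0) v });
     dN \<leftarrow> build_vec n (\<lambda>i. do {
             q \<leftarrow> divide_by (Istart s $ i) (Ineed s $ i);
             x \<leftarrow> mul (d0 $ i) q;
             sub 0 x });
     return (tp\<lparr> dr_dIstart := (dr_dIstart tp)(t := d0),
                 dr_dIneed := (dr_dIneed tp)(t := dN) \<rparr>) })"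

definition record_production ::
  "(nat \<Rightarrow> nat list) \<Rightarrow> inventory \<Rightarrow> nat \<Rightarrow> tape \<Rightarrow> tape timed" where
  "record_production stored sys t tp = (let s = sim sys t in
     for_each [0..<items sys] (\<lambda>i tp. do {
       z \<leftarrow> equal_to (Mst s $ i) 0;
       if \<not> z then do {
         u \<leftarrow> add_nat t (lead_time sys t i);
         l3 \<leftarrow> append_item (list3 tp u) i;
         l4 \<leftarrow> append_item (list4 tp u) (lead_time sys t i);
         k \<leftarrow> Timed (kmin s $ i) 1;
         x \<leftarrow> add (Ord s $ i) (Ordb (sim sys (t - 1)) $ i);
         d \<leftarrow> for_each (stored i) (\<lambda>j d. do {
                a \<leftarrow> equal_to (bom sys $$ (j, i)) 0;
                b \<leftarrow> equal_to (fill s $ j) k;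
                y \<leftarrow> mul x (if b \<and> \<not> a then 1 else 0);
                append_item d (j, y) }) [];
         return (tp\<lparr> list3 := (list3 tp)(u := l3), list4 := (list4 tp)(u := l4),
                     krec := (krec tp)(t := (krec tp t)(i := k)),
                     dM := (dM tp)(t := (dM tp t)(i := d)) \<rparr>) }
       else return tp }) tp)"

definition recording :: "(nat \<Rightarrow> nat list) \<Rightarrow> inventory \<Rightarrow> tape timed" where
  "recording stored sys = for_each [1..<Suc (horizon sys)] (\<lambda>t tp. do {
     tp \<leftarrow> record_orders sys t tp;
     tp \<leftarrow> record_inventory sys t tp;
     tp \<leftarrow> record_procurement sys t tp;
     tp \<leftarrow> record_fill sys t tp;
     record_production stored sys t tp }) empty_tape"


section \<open>Back-propagation, part 2: backward pass\<close>

text \<open>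
  The adjoint of \<open>X\<close> is \<open>\<partial>C\<^sub>T\<^sup>s\<^sup>u\<^sup>m/\<partial>X\<close>. At the start of the iteration for \<open>t\<close>, the components of
  this record are the adjoints of \<open>Itemp\<^sub>t\<^sub>+\<^sub>1\<close>, \<open>IP\<^sub>t\<close>, \<open>S\<close> and \<open>O\<^sup>b\<^sub>t\<close>, and those of \<open>r\<^sub>u\<close>, \<open>O\<^sub>u\<close>,
  \<open>M\<^sub>u\<close> for every period \<open>u\<close>.
\<close>

record adjoints =
  stack :: "real vec list"
  gItemp :: "real vec"
  gIP :: "real vec"
  gS :: "real vec"
  gOb :: "real vec"
  gr :: "nat \<Rightarrow> real vec"
  gO :: "nat \<Rightarrow> real vec"
  gM :: "nat \<Rightarrow> real vec"

definition zero_family :: "inventory \<Rightarrow> (nat \<Rightarrow> real vec) timed" where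
  "zero_family sys = for_each [1..<Suc (horizon sys)] (\<lambda>t f. do {
     z \<leftarrow> vec_zero (items sys); return (f(t := z)) }) (\<lambda>t. 0\<^sub>v 0)"

definition initial_adjoints :: "inventory \<Rightarrow> tape \<Rightarrow> adjoints timed" where
  "initial_adjoints sys tp = (let n = items sys in do {
     z1 \<leftarrow> vec_zero n; z2 \<leftarrow> vec_zero n; z3 \<leftarrow> vec_zero n; z4 \<leftarrow> vec_zero n;
     fr \<leftarrow> zero_family sys; fO \<leftarrow> zero_family sys; fM \<leftarrow> zero_family sys;
     return \<lparr> stack = stack1 tp, gItemp = z1, gIP = z2, gS = z3, gOb = z4,
              gr = fr, gO = fO, gM = fM \<rparr> })"

definition add_production ::
  "inventory \<Rightarrow> tape \<Rightarrow> nat \<Rightarrow> real vec \<Rightarrow> real vec \<Rightarrow> real vec timed" where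
  "add_production sys tp t m g = for_each [0..<items sys] (\<lambda>i g. do {
     z \<leftarrow> equal_to (Mst (sim sys t) $ i) 0;
     if \<not> z then for_each (dM tp t i) (\<lambda>(j, d) g. do {
         x \<leftarrow> mul (m $ i) d;
         y \<leftarrow> add (g $ j) x;
         assign g j y }) g
     else return g }) g"

text \<open>Pass \<open>(st, g\<^sub>S, g\<^sub>I\<^sub>P, g\<^sub>O)\<close> through one layer of the ordering loop.\<close>

definition layer_step ::
  "(nat \<Rightarrow> nat list) \<Rightarrow> inventory \<Rightarrow> real vec list \<times> real vec \<times> real vec \<times> real vec
    \<Rightarrow> (real vec list \<times> real vec \<times> real vec \<times> real vec) timed" where
  "layer_step stored sys = (\<lambda>(st, s, ip, ord). let n = items sys in do {
     (d, st) \<leftarrow> pop n st;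
     tmp \<leftarrow> vec_diag n ord d;
     s \<leftarrow> vec_sub n s tmp;
     ip \<leftarrow> vec_add n ip tmp;
     x \<leftarrow> vec_mat n stored tmp (bom sys);
     z \<leftarrow> vec_zero n;
     ord \<leftarrow> vec_sub n z x;
     return (st, s, ip, ord) })"

text \<open>\<open>for each (i, l)\<close> of the two lists of period \<open>t\<close>: assign \<open>p\<^sub>i\<close> to component \<open>i\<close> in period
  \<open>t - l\<close>.\<close>

definition send_back ::
  "nat \<Rightarrow> nat list \<Rightarrow> nat list \<Rightarrow> real vec \<Rightarrow> (nat \<Rightarrow> real vec) \<Rightarrow> (nat \<Rightarrow> real vec) timed" where
  "send_back t is ls p f = for_each (zip is ls) (\<lambda>(i, l) f. do {
     l \<leftarrow> Timed l 1;
     u \<leftarrow> sub_nat t l;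
     v \<leftarrow> assign (f u) i (p $ i);
     return (f(u := v)) }) f"

text \<open>
  The multipliers \<open>k\<^sub>t\<^sub>,\<^sub>i\<close> are read from the simulation, because \<open>diag((k\<^sub>t\<^sub>,\<^sub>i)\<^sub>i)\<close> also involves items
  whose started production is zero, for which the recording stores none.
  \<open>G(IP\<^sub>t)(E - A)\<close> is evaluated as \<open>G(IP\<^sub>t) - G(IP\<^sub>t) A\<close>.
\<close>

definition backward_step ::
  "(nat \<Rightarrow> nat list) \<Rightarrow> inventory \<Rightarrow> tape \<Rightarrow> nat \<Rightarrow> adjoints \<Rightarrow> adjoints timed" where
  "backward_step stored sys tp t a = (let n = items sys; A = bom sys in do {
     i \<leftarrow> vec_add n (holding sys) (gItemp a);
     b \<leftarrow> vec_sub n (penalty sys) (gItemp a);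

     x \<leftarrow> vec_mat n stored i A;
     m \<leftarrow> vec_sub n (gM a t) x;
     m \<leftarrow> vec_sub n m (gOb a);

     x \<leftarrow> vec_diag n m (kmin (sim sys t));
     o' \<leftarrow> vec_add n (gOb a) x;

     r \<leftarrow> add_production sys tp t m (gr a t);

     x \<leftarrow> vec_diag n r (dr_dIstart tp t);
     i0 \<leftarrow> vec_add n i x;
     need \<leftarrow> vec_diag n r (dr_dIneed tp t);
     x \<leftarrow> vec_mat n stored need A;
     o' \<leftarrow> vec_add n o' x;

     x \<leftarrow> vec_diag n i0 (dIstart_dItemp tp t);
     y \<leftarrow> vec_diag n b (dBout_dItemp tp t);
     itemp \<leftarrow> vec_add n x y;

     ord \<leftarrow> vec_add n (gO a t) o';
     x \<leftarrow> vec_mat n stored (gIP a) A;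
     y \<leftarrow> vec_sub n (gIP a) x;
     ord \<leftarrow> vec_add n ord y;

     (st, s, ip, ord) \<leftarrow> for_each [1..<layers sys] (\<lambda>_. layer_step stored sys)
                          (stack a, gS a, gIP a, ord);

     (d, st) \<leftarrow> pop n st;
     x \<leftarrow> vec_diag n ord d;
     s \<leftarrow> vec_sub n s x;
     ip \<leftarrow> vec_add n ip x;

     ob \<leftarrow> vec_copy n o';
     p \<leftarrow> vec_copy n itemp;

     fO \<leftarrow> send_back t (list1 tp t) (list2 tp t) p ((gO a)(t := ord));
     fM \<leftarrow> send_back t (list3 tp t) (list4 tp t) p ((gM a)(t := m));

     return \<lparr> stack = st, gItemp = itemp, gIP = ip, gS = s, gOb = ob,
              gr = (gr a)(t := r), gO = fO, gM = fM \<rparr> })"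

definition backward :: "(nat \<Rightarrow> nat list) \<Rightarrow> inventory \<Rightarrow> tape \<Rightarrow> adjoints timed" where
  "backward stored sys tp = do {
     a \<leftarrow> initial_adjoints sys tp;
     for_each (rev [1..<Suc (horizon sys)]) (backward_step stored sys tp) a }"

text \<open>
  The result is the row vector \<open>\<partial>C\<^sub>T\<^sup>s\<^sup>u\<^sup>m/\<partial>S\<close>. The values of the simulation are given, so the cost is
  that of recording and backward pass only.
\<close>

definition bp :: "(nat \<Rightarrow> nat list) \<Rightarrow> inventory \<Rightarrow> real vec timed" where
  "bp stored sys = do {
     tp \<leftarrow> recording stored sys;
     a \<leftarrow> backward stored sys tp;
     return (gS a) }"

definition dense :: "inventory \<Rightarrow> nat \<Rightarrow> nat list" where
  "dense sys j = [0..<items sys]"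

definition sparse :: "inventory \<Rightarrow> nat \<Rightarrow> nat list" where
  "sparse sys j = [i \<leftarrow> [0..<items sys]. bom sys $$ (i, j) \<noteq> 0]"

definition dense_complexity :: "inventory \<Rightarrow> nat" where
  "dense_complexity sys = cost (bp (dense sys) sys)"

definition sparse_complexity :: "inventory \<Rightarrow> nat" where
  "sparse_complexity sys = cost (bp (sparse sys) sys)"

end

theory Submission
  imports Defs
begin

text \<open>
  Let \<open>s\<close> be the number of stored entries of \<open>A\<close>. Every statement of the procedure is a loop over the
  items, over the stored entries, or over the items of a list, and the first two kinds occur
  \<open>O(n\<^sub>l)\<close> times per period. The lists of a single period can be long, as deliveries ordered in
  different periods may coincide; but each period appends at most \<open>2 n\<close> items in total, so summed
  over the horizon the lists contribute \<open>O(T n)\<close>. The total is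
  \<open>O(T n\<^sub>l (n + s))\<close>, where \<open>s = n\<^sup>2\<close> for dense and \<open>s = m\<close> for sparse storage.
\<close>

section \<open>Cost and value rules for the timed primitives and for loops\<close>

lemma cost_return [simp]: "cost (return x) = 0"
  and val_return [simp]: "val (return x) = x"
  by (simp_all add: return_def)

lemma cost_bind [simp]: "cost (timed_bind m f) = cost m + cost (f (val m))"
  and val_bind [simp]: "val (timed_bind m f) = val (f (val m))"
  by (simp_all add: timed_bind_def)

lemma cost_scalar [simp]:
  "cost (add x y) = 1" "cost (sub x y) = 1" "cost (mul x y) = 1" "cost (divide_by x y) = 1"
  "cost (less_than x y) = 1" "cost (equal_to x y) = 1"
  "cost (add_nat k l) = 1" "cost (sub_nat k l) = 1"
  "cost (assign v k x) = 1" "cost (append_item xs a) = 1"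
  "cost (push n v st) = n" "cost (pop n st) = n"
  by (simp_all add: add_def sub_def mul_def divide_by_def less_than_def equal_to_def add_nat_def
      sub_nat_def assign_def append_item_def push_def pop_def)

lemma val_append_item [simp]: "val (append_item xs x) = xs @ [x]"
  by (simp add: append_item_def)

lemma cost_build_vec: "cost (build_vec n f) = (\<Sum>i<n. cost (f i) + 2)"
  by (simp add: build_vec_def)

lemma cost_vec [simp]:
  "cost (vec_zero n) = 2 * n" "cost (vec_copy n u) = 2 * n"
  "cost (vec_add n u v) = 3 * n" "cost (vec_sub n u v) = 3 * n" "cost (vec_diag n u v) = 3 * n"
  by (simp_all add: vec_zero_def vec_copy_def vec_add_def vec_sub_def vec_diag_def cost_build_vec)

lemma cost_for_each_le:
  assumes "\<And>x s. x \<in> set xs \<Longrightarrow> cost (body x s) \<le> b x"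
  shows "cost (for_each xs body s) \<le> (\<Sum>x\<leftarrow>xs. b x + 1)"
  using assms
proof (induction xs arbitrary: s)
  case (Cons x xs)
  have "cost (body x s) \<le> b x" "\<And>s. cost (for_each xs body s) \<le> (\<Sum>x\<leftarrow>xs. b x + 1)"
    using Cons by simp_all
  then show ?case
    by (simp add: add_mono)
qed simp

lemma cost_for_each_const:
  assumes "\<And>x s. x \<in> set xs \<Longrightarrow> cost (body x s) = c"
  shows "cost (for_each xs body s) = (c + 1) * length xs"
  using assms by (induction xs arbitrary: s) simp_all

lemma for_each_invariant:
  assumes "I s" and "\<And>x s. x \<in> set xs \<Longrightarrow> I s \<Longrightarrow> I (val (body x s))"
  shows "I (val (for_each xs body s))"
  using assms by (induction xs arbitrary: s) simp_all

text \<open>Here \<open>f\<close> measures the size of a data structure held in the state; this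
  later bounds the lists on the tape.\<close>

lemma for_each_growth:
  fixes f :: "'s \<Rightarrow> nat"
  assumes "\<And>x s. x \<in> set xs \<Longrightarrow> f (val (body x s)) \<le> f s + c"
  shows "f (val (for_each xs body s)) \<le> f s + c * length xs"
  using assms
proof (induction xs arbitrary: s)
  case (Cons x xs)
  have "f (val (for_each xs body (val (body x s)))) \<le> f (val (body x s)) + c * length xs"
    using Cons by simp
  also have "f (val (body x s)) \<le> f s + c"
    using Cons by simp
  finally show ?case
    by simp
qed simp

definition stored_entries :: "nat \<Rightarrow> (nat \<Rightarrow> nat list) \<Rightarrow> nat" where
  "stored_entries n stored = (\<Sum>j<n. length (stored j))"

text \<open>A stored entry pays a multiplication, an addition and a loop comparison; a column pays a
  comparison and an assignment.\<close>

lemma cost_vec_mat [simp]: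
  "cost (vec_mat n stored u A) = 3 * stored_entries n stored + 2 * n"
proof -
  have "cost (vec_mat n stored u A) = (\<Sum>j<n. 3 * length (stored j) + 2)"
    by (simp add: vec_mat_def cost_build_vec cost_for_each_const[where c = 2])
  also have "\<dots> = 3 * stored_entries n stored + 2 * n"
    by (simp only: sum.distrib sum_distrib_left stored_entries_def) simp
  finally show ?thesis .
qed

lemma sum_list_upt_eq_sum: "(\<Sum>i\<leftarrow>[0..<n]. f i) = (\<Sum>i<n. f i)"
  by (simp add: interv_sum_list_conv_sum_set_nat lessThan_atLeast0)


section \<open>Cost of the recording\<close>

lemma cost_record_orders:
  "cost (record_orders sys t tp) = 6 * items sys + (5 * items sys + 1) * (layers sys - 1)"
  by (simp add: record_orders_def neg_indicator_def Let_def cost_build_vec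
      cost_for_each_const[where c = "5 * items sys"])

lemma cost_record_inventory: "cost (record_inventory sys t tp) = 6 * items sys"
  by (simp add: record_inventory_def Let_def cost_build_vec)

lemma cost_record_procurement: "cost (record_procurement sys t tp) \<le> 6 * items sys"
  unfolding record_procurement_def Let_def
  by (rule order_trans[OF cost_for_each_le[where b = "\<lambda>_. 5"]])
    (simp_all add: sum_list_triv)

lemma cost_record_fill: "cost (record_fill sys t tp) = 12 * items sys"
  by (simp add: record_fill_def Let_def cost_build_vec)

lemma cost_record_production:
  "cost (record_production stored sys t tp)
     \<le> 7 * items sys + 5 * stored_entries (items sys) stored"
  unfolding record_production_def Let_def
  by (rule order_trans[OF cost_for_each_le[where b = "\<lambda>i. 6 + 5 * length (stored i)"]])
    (simp_all add: cost_for_each_const[where c = 4] sum_list_upt_eq_sum sum.distrib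
      stored_entries_def flip: sum_distrib_left)

text \<open>Names the loop body of \<open>recording\<close>, so that cost, list growth and the bound
  on \<open>dM\<close> can be shown for one period and lifted through the loop.\<close>

definition record_period ::
  "(nat \<Rightarrow> nat list) \<Rightarrow> inventory \<Rightarrow> nat \<Rightarrow> tape \<Rightarrow> tape timed" where
  "record_period stored sys t tp = do {
     tp \<leftarrow> record_orders sys t tp;
     tp \<leftarrow> record_inventory sys t tp;
     tp \<leftarrow> record_procurement sys t tp;
     tp \<leftarrow> record_fill sys t tp;
     record_production stored sys t tp }"

lemma recording_eq:
  "recording stored sys = for_each [1..<Suc (horizon sys)] (record_period stored sys) empty_tape"
  by (simp add: recording_def record_period_def [abs_def])

lemma cost_record_period:
  "cost (record_period stored sys t tp)
     \<le> 37 * items sys + 5 * stored_entries (items sys) stored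
       + (5 * items sys + 1) * (layers sys - 1)"
proof -
  \<comment> \<open>The tapes on entry to the two stages whose cost is only bounded, not computed
    exactly.\<close>
  define tp1 where "tp1 = val (record_inventory sys t (val (record_orders sys t tp)))"
  define tp2 where "tp2 = val (record_fill sys t (val (record_procurement sys t tp1)))"
  show ?thesis
    using cost_record_procurement[of sys t tp1] cost_record_production[of stored sys t tp2]
    by (simp add: record_period_def cost_record_orders cost_record_inventory cost_record_fill
        flip: tp1_def tp2_def)
qed

lemma cost_recording:
  "cost (recording stored sys)
     \<le> horizon sys * (37 * items sys + 5 * stored_entries (items sys) stored
       + (5 * items sys + 1) * (layers sys - 1) + 1)"
  unfolding recording_eq
  by (rule order_trans[OF cost_for_each_le[OF cost_record_period]]) (simp add: sum_list_triv)


section \<open>Size of the tape\<close>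

text \<open>The potential of the amortised count. Deliveries may fall after the horizon, so it is
  taken over a set \<open>U\<close> of delivery periods.\<close>

definition entries :: "nat set \<Rightarrow> (nat \<Rightarrow> nat list) \<Rightarrow> nat" where
  "entries U f = (\<Sum>u\<in>U. length (f u))"

lemma entries_snoc: "entries U (f(u := f u @ [i])) \<le> entries U f + 1"
proof (cases "finite U \<and> u \<in> U")
  case True
  then have "entries U f = length (f u) + entries (U - {u}) f" for f
    by (simp add: entries_def sum.remove[of U u])
  moreover have "entries (U - {u}) (f(u := f u @ [i])) = entries (U - {u}) f"
    by (simp add: entries_def)
  ultimately show ?thesis
    by simp
next
  \<comment> \<open>For infinite \<open>U\<close> both sums are 0 by convention; for
    \<open>u\<close> outside \<open>U\<close> the extended list is not counted.\<close>
  case False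
  then show ?thesis
    by (cases "finite U") (auto simp: entries_def intro!: le_SucI sum_mono)
qed

text \<open>The tape enters the cost bound of the backward pass only through the loops over
  \<open>list1\<close>, \<open>list3\<close> and \<open>dM\<close>, so these fields are followed
  through every stage.\<close>

lemma record_orders_tape [simp]:
  "list1 (val (record_orders sys t tp)) = list1 tp"
  "list3 (val (record_orders sys t tp)) = list3 tp"
  "dM (val (record_orders sys t tp)) = dM tp"
  by (simp_all add: record_orders_def Let_def)

lemma record_inventory_tape [simp]:
  "list1 (val (record_inventory sys t tp)) = list1 tp"
  "list3 (val (record_inventory sys t tp)) = list3 tp"
  "dM (val (record_inventory sys t tp)) = dM tp"
  by (simp_all add: record_inventory_def Let_def)

lemma record_fill_tape [simp]:
  "list1 (val (record_fill sys t tp)) = list1 tp"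
  "list3 (val (record_fill sys t tp)) = list3 tp"
  "dM (val (record_fill sys t tp)) = dM tp"
  by (simp_all add: record_fill_def Let_def)

lemma record_procurement_tape [simp]:
  "list3 (val (record_procurement sys t tp)) = list3 tp"
  "dM (val (record_procurement sys t tp)) = dM tp"
  unfolding record_procurement_def Let_def
  by (rule for_each_invariant[where I = "\<lambda>tp'. list3 tp' = list3 tp"]; simp)
    (rule for_each_invariant[where I = "\<lambda>tp'. dM tp' = dM tp"]; simp)

lemma entries_record_procurement:
  "entries U (list1 (val (record_procurement sys t tp))) \<le> entries U (list1 tp) + items sys"
  unfolding record_procurement_def Let_def
  using for_each_growth[where f = "\<lambda>tp. entries U (list1 tp)" and c = 1 and xs = "[0..<items sys]"]
  by (rule order_trans) (simp_all add: entries_snoc[simplified])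

lemma record_production_tape [simp]:
  "list1 (val (record_production stored sys t tp)) = list1 tp"
  unfolding record_production_def Let_def
  by (rule for_each_invariant[where I = "\<lambda>tp'. list1 tp' = list1 tp"]; simp)

lemma entries_record_production:
  "entries U (list3 (val (record_production stored sys t tp))) \<le> entries U (list3 tp) + items sys"
  unfolding record_production_def Let_def
  using for_each_growth[where f = "\<lambda>tp. entries U (list3 tp)" and c = 1 and xs = "[0..<items sys]"]
  by (rule order_trans) (simp_all add: entries_snoc[simplified])

text \<open>Controls the inner loop of \<open>add_production\<close>, which runs over the recorded
  derivatives rather than over the stored column itself.\<close>

definition dM_bounded :: "(nat \<Rightarrow> nat list) \<Rightarrow> tape \<Rightarrow> bool" where
  "dM_bounded stored tp \<longleftrightarrow> (\<forall>t i. length (dM tp t i) \<le> length (stored i))"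

lemma dM_bounded_record_production:
  assumes "dM_bounded stored tp"
  shows "dM_bounded stored (val (record_production stored sys t tp))"
proof -
  \<comment> \<open>The list for item \<open>i\<close> is rebuilt from \<open>[]\<close> with one
    append per stored row index, whatever was recorded before.\<close>
  have *: "length (val (for_each (stored i) (\<lambda>j d. timed_bind (equal_to (bom sys $$ (j, i)) 0) (\<lambda>a.
      timed_bind (equal_to (fill (sim sys t) $ j) k) (\<lambda>b.
      timed_bind (mul x (if b \<and> \<not> a then 1 else 0)) (\<lambda>y. append_item d (j, y))))) []))
        \<le> length (stored i)" for i k and x :: real
    using for_each_growth[where f = length and c = 1 and s = "[]" and xs = "stored i"]
    by (rule order_trans) simp_all
  show ?thesis
    unfolding record_production_def Let_def using assms
    by (rule for_each_invariant) (auto simp: dM_bounded_def intro!: *[simplified])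
qed

lemma dM_bounded_recording: "dM_bounded stored (val (recording stored sys))"
  unfolding recording_eq
proof (rule for_each_invariant)
  show "dM_bounded stored empty_tape"
    by (simp add: dM_bounded_def empty_tape_def)
  show "dM_bounded stored (val (record_period stored sys t tp))"
    if "dM_bounded stored tp" for t tp
    unfolding record_period_def val_bind
    by (rule dM_bounded_record_production) (use that in \<open>simp add: dM_bounded_def\<close>)
qed

text \<open>Each recorded period visits every item once and appends at most one entry to each kind
  of list, wherever the lead times place it.\<close>

lemma entries_recording:
  "entries U (list1 (val (recording stored sys))) \<le> items sys * horizon sys"
  "entries U (list3 (val (recording stored sys))) \<le> items sys * horizon sys"
proof -
  have 1: "entries U (list1 (val (record_period stored sys t tp)))
      \<le> entries U (list1 tp) + items sys" for t tp
    unfolding record_period_def val_bind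
    using entries_record_procurement[of U sys t
        "val (record_inventory sys t (val (record_orders sys t tp)))"]
    by simp
  have 3: "entries U (list3 (val (record_period stored sys t tp)))
      \<le> entries U (list3 tp) + items sys" for t tp
    unfolding record_period_def val_bind
    by (rule order_trans[OF entries_record_production]) simp
  have "entries U (list1 empty_tape) = 0" "entries U (list3 empty_tape) = 0"
    by (simp_all add: entries_def empty_tape_def)
  with
    for_each_growth[where f = "\<lambda>tp. entries U (list1 tp)" and xs = "[1..<Suc (horizon sys)]"
      and body = "record_period stored sys" and s = empty_tape, OF 1]
    for_each_growth[where f = "\<lambda>tp. entries U (list3 tp)" and xs = "[1..<Suc (horizon sys)]"
      and body = "record_period stored sys" and s = empty_tape, OF 3]
  show
    "entries U (list1 (val (recording stored sys))) \<le> items sys * horizon sys"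
    "entries U (list3 (val (recording stored sys))) \<le> items sys * horizon sys"
    by (simp_all only: recording_eq length_upt diff_Suc_1 One_nat_def diff_Suc_Suc diff_zero add_0)
qed


section \<open>Cost of the backward pass\<close>

lemma cost_zero_family: "cost (zero_family sys) = (2 * items sys + 1) * horizon sys"
  by (simp add: zero_family_def cost_for_each_const[where c = "2 * items sys"])

lemma cost_initial_adjoints:
  "cost (initial_adjoints sys tp) = 8 * items sys + 3 * ((2 * items sys + 1) * horizon sys)"
  by (simp add: initial_adjoints_def Let_def cost_zero_family)

lemma cost_add_production:
  assumes "dM_bounded stored tp"
  shows "cost (add_production sys tp t m g)
    \<le> 2 * items sys + 4 * stored_entries (items sys) stored"
proof -
  have "cost (add_production sys tp t m g) \<le> (\<Sum>i\<leftarrow>[0..<items sys]. 1 + 4 * length (stored i) + 1)"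
    unfolding add_production_def
  proof (rule cost_for_each_le, goal_cases)
    case (1 i g)
    have "cost (for_each (dM tp t i) (\<lambda>(j, d) g. timed_bind (mul (m $ i) d) (\<lambda>x.
        timed_bind (add (g $ j) x) (\<lambda>y. assign g j y))) g) = 4 * length (dM tp t i)"
      by (subst cost_for_each_const[where c = 3]) (auto split: prod.splits)
    moreover have "length (dM tp t i) \<le> length (stored i)"
      using assms by (simp add: dM_bounded_def)
    ultimately show ?case
      by simp
  qed
  also have "\<dots> = (\<Sum>i<items sys. 2 + 4 * length (stored i))"
    by (simp add: sum_list_upt_eq_sum)
  also have "\<dots> = 2 * items sys + 4 * stored_entries (items sys) stored"
    by (simp only: sum.distrib sum_distrib_left stored_entries_def) simp
  finally show ?thesis .
qed

lemma cost_layer_step: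
  "cost (layer_step stored sys x) = 17 * items sys + 3 * stored_entries (items sys) stored"
  by (simp add: layer_step_def Let_def split_beta)

text \<open>\<open>zip\<close> stops at the shorter list, so the length of the first list suffices
  and the lead-time lists need not be measured.\<close>

lemma cost_send_back: "cost (send_back t is ls p f) \<le> 4 * length is"
proof -
  have "cost (send_back t is ls p f) = 4 * length (zip is ls)"
    unfolding send_back_def
    by (subst cost_for_each_const[where c = 3]) (auto split: prod.splits)
  then show ?thesis
    by simp
qed

text \<open>The bound \<open>b\<close> is uniform in \<open>x\<close>, so a long sequence of
  statements can be bounded by its syntax alone, without knowing the intermediate values.\<close>

lemma cost_bind_le:
  assumes "cost m \<le> a" and "\<And>x. cost (f x) \<le> b"
  shows "cost (timed_bind m f) \<le> a + b"
  using assms by (simp add: add_mono)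

lemma cost_case_prod_le:
  assumes "\<And>a b. cost (f a b) \<le> c"
  shows "cost (case p of (a, b) \<Rightarrow> f a b) \<le> c"
  using assms by (cases p) simp

lemma cost_backward_step:
  assumes "dM_bounded stored tp"
  shows "cost (backward_step stored sys tp t a)
    \<le> 70 * items sys + 13 * stored_entries (items sys) stored
      + (17 * items sys + 3 * stored_entries (items sys) stored + 1) * (layers sys - 1)
      + 4 * length (list1 tp t) + 4 * length (list3 tp t)"
  unfolding backward_step_def Let_def
  \<comment> \<open>The middle term stays schematic; the rules below assemble it with one summand
    per statement, and arithmetic then compares it with the claim.\<close>
  apply (rule order_trans)
   apply (rule cost_bind_le cost_case_prod_le cost_add_production[OF assms] cost_send_back
      cost_vec[THEN eq_refl] cost_vec_mat[THEN eq_refl] cost_scalar(12)[THEN eq_refl]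
      cost_for_each_const[OF cost_layer_step, THEN eq_refl] cost_return[THEN eq_refl])+
  apply simp
  done

lemma cost_backward:
  assumes "dM_bounded stored tp"
    and "entries {1..horizon sys} (list1 tp) \<le> items sys * horizon sys"
    and "entries {1..horizon sys} (list3 tp) \<le> items sys * horizon sys"
  shows "cost (backward stored sys tp) \<le> 8 * items sys + horizon sys *
    (84 * items sys + 13 * stored_entries (items sys) stored + 4
      + (17 * items sys + 3 * stored_entries (items sys) stored + 1) * (layers sys - 1))"
proof -
  \<comment> \<open>The part of the bound common to all periods; the list lengths vary with
    \<open>t\<close> and are kept apart.\<close>
  define c where "c = 70 * items sys + 13 * stored_entries (items sys) stored
      + (17 * items sys + 3 * stored_entries (items sys) stored + 1) * (layers sys - 1)"
  have "cost (for_each (rev [1..<Suc (horizon sys)]) (backward_step stored sys tp)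
        (val (initial_adjoints sys tp)))
      \<le> (\<Sum>t\<leftarrow>rev [1..<Suc (horizon sys)].
            c + 4 * length (list1 tp t) + 4 * length (list3 tp t) + 1)"
    using cost_backward_step[OF assms(1)] by (intro cost_for_each_le) (simp add: c_def)
  \<comment> \<open>The backward order does not affect the sum; over a set, the list lengths collect
    into \<open>entries\<close>.\<close>
  also have "\<dots> = (\<Sum>t\<in>{1..horizon sys}. c + 4 * length (list1 tp t) + 4 * length (list3 tp t) + 1)"
    by (simp only: rev_map [symmetric] sum_list_rev interv_sum_list_conv_sum_set_nat set_upt
        atLeastLessThanSuc_atLeastAtMost)
  also have "\<dots> = horizon sys * (c + 1) + 4 * entries {1..horizon sys} (list1 tp)
      + 4 * entries {1..horizon sys} (list3 tp)"
    by (simp only: sum.distrib sum_distrib_left entries_def) simp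
  also have "\<dots> \<le> horizon sys * (c + 1) + 8 * (items sys * horizon sys)"
    using assms(2,3) by simp
  finally have "cost (backward stored sys tp)
      \<le> 8 * items sys + 3 * ((2 * items sys + 1) * horizon sys)
        + (horizon sys * (c + 1) + 8 * (items sys * horizon sys))"
    by (simp add: backward_def cost_initial_adjoints mult.commute[of "horizon sys"]
        del: upt_Suc)
  \<comment> \<open>The 14 consists of 6 for the three zero families and 8 for the two kinds of
    lists; the 4 counts the comparisons of the main loop and of the three family loops.\<close>
  also have "\<dots> = 8 * items sys + horizon sys * (c + 14 * items sys + 4)"
    by (simp add: algebra_simps)
  finally show ?thesis
    by (simp add: c_def algebra_simps)
qed

section \<open>Total cost of recording and backward pass\<close>

lemma cost_bp:
  assumes "inventory_system sys"
  shows "cost (bp stored sys)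
    \<le> 134 * (horizon sys * layers sys * (items sys + stored_entries (items sys) stored))"
proof -
  define n T l m where "n = items sys" and "T = horizon sys" and "l = layers sys - 1"
    and "m = stored_entries (items sys) stored"
  have layers: "layers sys = l + 1"
    by (simp add: l_def layers_def)
  have n: "n \<ge> 1" and T: "T \<ge> 1"
    using assms by (simp_all add: inventory_system_def n_def T_def)
  have "cost (bp stored sys) \<le> T * (37 * n + 5 * m + (5 * n + 1) * l + 1)
      + (8 * n + T * (84 * n + 13 * m + 4 + (17 * n + 3 * m + 1) * l))"
    using cost_recording[of stored sys]
      cost_backward[OF dM_bounded_recording entries_recording, of stored sys]
    by (simp add: bp_def n_def T_def l_def m_def)
  \<comment> \<open>\<open>n \<ge> 1\<close> turns additive constants into multiples of
    \<open>n\<close>, and \<open>T \<ge> 1\<close> absorbs the one-off \<open>8 * n\<close>. The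
    coefficients of \<open>n\<close> outside the layer loop then add up to 134, which serves as
    common constant.\<close>
  also have "\<dots> \<le> T * (37 * n + 5 * m + (5 * n + n) * l + n)
      + (8 * (T * n) + T * (84 * n + 13 * m + 4 * n + (17 * n + 3 * m + n) * l))"
    using n T by (intro add_mono mult_le_mono order.refl) simp_all
  also have "\<dots> = T * (134 * n + 18 * m + (24 * n + 3 * m) * l)"
    by (simp add: algebra_simps)
  also have "\<dots> \<le> T * (134 * n + 134 * m + (134 * n + 134 * m) * l)"
    by (intro add_mono mult_le_mono order.refl) simp_all
  also have "\<dots> = 134 * (T * layers sys * (n + m))"
    by (simp add: layers algebra_simps)
  finally show ?thesis
    by (simp add: n_def T_def m_def)
qed


section \<open>Asymptotics\<close>

lemma stored_entries_dense: "stored_entries (items sys) (dense sys) = items sys ^ 2"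
  by (simp add: stored_entries_def dense_def power2_eq_square)

lemma stored_entries_sparse: "stored_entries (items sys) (sparse sys) = arcs sys"
proof -
  let ?n = "items sys"
  \<comment> \<open>Column lists enumerate the arcs with the column first, whereas
    \<open>arcs\<close> counts row-column pairs; hence the swap below.\<close>
  let ?S = "SIGMA j:{..<?n}. {i. i < ?n \<and> bom sys $$ (i, j) \<noteq> 0}"
  have "length (sparse sys j) = card {i. i < ?n \<and> bom sys $$ (i, j) \<noteq> 0}" for j
    by (simp add: sparse_def length_filter_conv_card cong: conj_cong)
  then have "stored_entries ?n (sparse sys) = card ?S"
    by (simp add: stored_entries_def)
  also have "\<dots> = card (prod.swap ` ?S)"
    by (simp add: card_image)
  also have "prod.swap ` ?S = {(i, j). i < ?n \<and> j < ?n \<and> bom sys $$ (i, j) \<noteq> 0}"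
    by force
  finally show ?thesis
    by (simp add: arcs_def)
qed

text \<open>A loop at \<open>i\<close> would give walks from \<open>i\<close> to itself of every
  length, making \<open>path_lengths\<close> unbounded.\<close>

lemma bom_diag_zero:
  assumes "inventory_system sys" and i: "i < items sys"
  shows "bom sys $$ (i, i) = 0"
proof (rule ccontr)
  define A where "A = bom sys"
  assume "bom sys $$ (i, i) \<noteq> 0"
  then have pos: "A $$ (i, i) > 0"
    using assms by (simp add: inventory_system_def A_def order_less_le)
  have A: "A \<in> carrier_mat (items sys) (items sys)"
    and nonneg: "\<And>j k. j < items sys \<Longrightarrow> k < items sys \<Longrightarrow> A $$ (j, k) \<ge> 0"
    using assms(1) by (simp_all add: inventory_system_def A_def)
  have pow: "A ^\<^sub>m r \<in> carrier_mat (items sys) (items sys)" for r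
    using A by simp
  \<comment> \<open>Nonnegativity of the whole row is carried along so that the diagonal entry of
    the next power is at least its single summand at \<open>k = i\<close>.\<close>
  have "(\<forall>j<items sys. (A ^\<^sub>m r) $$ (i, j) \<ge> 0) \<and> (A ^\<^sub>m r) $$ (i, i) > 0" for r
  proof (induction r)
    case 0
    then show ?case
      using A i by simp
  next
    case (Suc r)
    have entry: "(A ^\<^sub>m Suc r) $$ (i, j) = (\<Sum>k<items sys. (A ^\<^sub>m r) $$ (i, k) * A $$ (k, j))"
      if "j < items sys" for j
      using A pow[of r] i that by (simp add: scalar_prod_def lessThan_atLeast0)
    have "0 < (A ^\<^sub>m r) $$ (i, i) * A $$ (i, i)"
      using Suc pos by simp
    also have "\<dots> \<le> (A ^\<^sub>m Suc r) $$ (i, i)"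
      unfolding entry[OF i]
      by (rule member_le_sum[where f = "\<lambda>k. (A ^\<^sub>m r) $$ (i, k) * A $$ (k, i)"])
        (use Suc i nonneg in auto)
    finally show ?case
      using entry Suc nonneg by (auto intro!: sum_nonneg)
  qed
  then have "path_lengths sys = UNIV"
    using i by (auto simp: path_lengths_def A_def)
  then show False
    using assms(1) by (simp add: inventory_system_def bdd_above_nat)
qed

text \<open>For a single item the density is the junk value \<open>0 / 0 = 0\<close>; the identity then holds because
  acyclicity excludes a loop.\<close>

lemma arcs_eq_density:
  assumes "inventory_system sys"
  shows "real (arcs sys) = density sys * real (items sys) * (real (items sys) - 1)"
proof (cases "items sys = 1")
  case True
  then have "{(i, j). i < items sys \<and> j < items sys \<and> bom sys $$ (i, j) \<noteq> 0} = {}"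
    using bom_diag_zero[OF assms, of 0] by (auto intro!: gr0I)
  then have "arcs sys = 0"
    unfolding arcs_def by (simp only: card.empty)
  with True show ?thesis
    by simp
next
  case False
  then show ?thesis
    using assms by (simp add: density_def inventory_system_def)
qed

lemma density_nonneg: "density sys \<ge> 0"
  by (cases "items sys") (simp_all add: density_def)

text \<open>The common core of the three claims: with boundedly many layers, each reduces to a
  pointwise bound on items plus stored entries.\<close>

lemma cost_bp_bigo:
  fixes sys :: "'i \<Rightarrow> inventory"
  assumes sys: "\<forall>\<^sub>F x in F. inventory_system (sys x)"
    and layers: "(\<lambda>x. real (layers (sys x))) \<in> O[F](\<lambda>x. 1)"
    and g: "\<forall>\<^sub>F x in F.
      real (items (sys x) + stored_entries (items (sys x)) (stored (sys x))) \<le> c * g x"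
  shows "(\<lambda>x. real (cost (bp (stored (sys x)) (sys x)))) \<in> O[F](\<lambda>x. real (horizon (sys x)) * g x)"
proof -
  let ?s = "\<lambda>x. items (sys x) + stored_entries (items (sys x)) (stored (sys x))"
  have "(\<lambda>x. real (cost (bp (stored (sys x)) (sys x))))
      \<in> O[F](\<lambda>x. real (134 * (horizon (sys x) * layers (sys x) * ?s x)))"
    by (rule landau_o.bigI[where c = 1])
      (use sys in \<open>auto elim!: eventually_mono simp del: of_nat_mult of_nat_add dest: cost_bp\<close>)
  also have "(\<lambda>x. real (134 * (horizon (sys x) * layers (sys x) * ?s x)))
      \<in> O[F](\<lambda>x. real (horizon (sys x)) * 1 * g x)"
  proof -
    have "(\<lambda>x. real (?s x)) \<in> O[F](g)"
      \<comment> \<open>The absolute value is taken because the sign of \<open>c\<close> is not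
        fixed.\<close>
      using g by (intro bigoI[where c = "\<bar>c\<bar>"])
        (auto elim!: eventually_mono simp flip: abs_mult)
    then have "(\<lambda>x. 134 * (real (horizon (sys x)) * real (layers (sys x)) * real (?s x)))
        \<in> O[F](\<lambda>x. real (horizon (sys x)) * 1 * g x)"
      using layers by (intro landau_o.big.cmult_in_iff[THEN iffD2] landau_o.big_mult) simp_all
    then show ?thesis
      by simp
  qed
  finally show ?thesis
    by simp
qed

text \<open>The filter lets items, arcs and horizon vary jointly. Bounded layers absorb the factor
  from the ordering loop. In the second claim, the premise that items are \<open>O\<close> of arcs
  lets the sparse product cost absorb the vector operations, which stay linear in the number of
  items.\<close>

theorem theorem3:
  fixes sys :: "'i \<Rightarrow> inventory" and F :: "'i filter"
  assumes "\<forall>\<^sub>F x in F. inventory_system (sys x)"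
    and layers_bounded: "(\<lambda>x. real (layers (sys x))) \<in> O[F](\<lambda>x. 1)"
  shows "(\<lambda>x. real (dense_complexity (sys x)))
           \<in> O[F](\<lambda>x. real (horizon (sys x)) * real (items (sys x)) ^ 2)
    \<and> ((\<lambda>x. real (items (sys x))) \<in> O[F](\<lambda>x. real (arcs (sys x))) \<longrightarrow>
        (\<lambda>x. real (sparse_complexity (sys x)))
           \<in> O[F](\<lambda>x. real (horizon (sys x)) * density (sys x) * real (items (sys x)) ^ 2))
    \<and> ((\<lambda>x. real (items (sys x)) * density (sys x)) \<in> O[F](\<lambda>x. 1) \<longrightarrow>
        (\<lambda>x. real (sparse_complexity (sys x)))
           \<in> O[F](\<lambda>x. real (horizon (sys x)) * real (items (sys x))))"
proof (intro conjI impI)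
  show "(\<lambda>x. real (dense_complexity (sys x)))
      \<in> O[F](\<lambda>x. real (horizon (sys x)) * real (items (sys x)) ^ 2)"
    unfolding dense_complexity_def
  proof (rule cost_bp_bigo[OF assms, where c = 2])
    show "\<forall>\<^sub>F x in F. real (items (sys x) + stored_entries (items (sys x)) (dense (sys x)))
        \<le> 2 * real (items (sys x)) ^ 2"
      using assms(1)
      by eventually_elim (simp add: stored_entries_dense power2_eq_square inventory_system_def)
  qed
  show "(\<lambda>x. real (sparse_complexity (sys x)))
      \<in> O[F](\<lambda>x. real (horizon (sys x)) * density (sys x) * real (items (sys x)) ^ 2)"
    if bigo: "(\<lambda>x. real (items (sys x))) \<in> O[F](\<lambda>x. real (arcs (sys x)))"
  proof -
    obtain c where c: "c > 0" "\<forall>\<^sub>F x in F. real (items (sys x)) \<le> c * real (arcs (sys x))"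
      using bigo by (rule landau_o.bigE) simp
    show ?thesis
      unfolding sparse_complexity_def mult.assoc
    \<comment> \<open>The \<open>c\<close> pays for the items through the arcs, the 1 for the stored
      entries; arcs are at most density times the squared number of items.\<close>
    proof (rule cost_bp_bigo[OF assms, where c = "c + 1"])
      show "\<forall>\<^sub>F x in F. real (items (sys x) + stored_entries (items (sys x)) (sparse (sys x)))
          \<le> (c + 1) * (density (sys x) * real (items (sys x)) ^ 2)"
        using c(2) assms(1)
      proof eventually_elim
        case (elim x)
        let ?n = "items (sys x)"
        have "density (sys x) * real ?n * (real ?n - 1) \<le> density (sys x) * real ?n * real ?n"
          using density_nonneg[of "sys x"] by (intro mult_left_mono) simp_all
        then have "arcs (sys x) \<le> density (sys x) * real ?n ^ 2"
          using arcs_eq_density[OF elim(2)] by (simp add: power2_eq_square mult.assoc)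
        then have "(c + 1) * arcs (sys x) \<le> (c + 1) * (density (sys x) * real ?n ^ 2)"
          using c(1) by (intro mult_left_mono) simp_all
        with elim show ?case
          by (simp add: stored_entries_sparse algebra_simps)
      qed
    qed
  qed
  show "(\<lambda>x. real (sparse_complexity (sys x)))
      \<in> O[F](\<lambda>x. real (horizon (sys x)) * real (items (sys x)))"
    if bigo: "(\<lambda>x. real (items (sys x)) * density (sys x)) \<in> O[F](\<lambda>x. 1)"
  proof -
    obtain c where c: "c > 0" "\<forall>\<^sub>F x in F. real (items (sys x)) * density (sys x) \<le> c"
      using bigo by (rule landau_o.bigE) (simp add: abs_mult density_nonneg)
    show ?thesis
      unfolding sparse_complexity_def
    \<comment> \<open>Now \<open>c\<close> pays for the stored entries, since the average in-degree
      is at most \<open>c\<close>, and the 1 for the items.\<close>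
    proof (rule cost_bp_bigo[OF assms, where c = "c + 1"])
      show "\<forall>\<^sub>F x in F. real (items (sys x) + stored_entries (items (sys x)) (sparse (sys x)))
          \<le> (c + 1) * real (items (sys x))"
        using c(2) assms(1)
      proof eventually_elim
        case (elim x)
        let ?n = "items (sys x)"
        have "density (sys x) * real ?n * (real ?n - 1) \<le> c * (real ?n - 1)"
          using elim
          by (intro mult_right_mono) (simp_all add: mult.commute inventory_system_def)
        also have "\<dots> \<le> c * real ?n"
          using c(1) by simp
        finally have "arcs (sys x) \<le> c * real ?n"
          using arcs_eq_density[OF elim(2)] by simp
        then show ?case
          by (simp add: stored_entries_sparse algebra_simps)
      qed
    qed
  qed
qed

end
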